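(* Let $\mathbf{C}$ be a subcategory of $\mathbf{B}$, and let $(G_n,R^m_n)$ and $(H_n,Q^m_n)$ be sequences in $\mathbf{C}$ with induced posets $\mathbb{P}$ and $\mathbb{Q}$, respectively. Suppose that one of the following holds: (1) both sequences are lax-Fraïssé in $\mathbf{C}$ and both have edge-witnessing star-refining subsequences; (2) both sequences are Fraïssé in $\mathbf{C}$. Then the spectra $\mathsf{S}\mathbb{P}$ and $\mathsf{S}\mathbb{Q}$ are homeomorphic.
   Context: Graphs and relations. A graph is a finite non-empty set $G$ with a reflexive symmetric relation $\sqcap$ (the edge relation). A relation $R\subseteq H\times G$ between graphs is viewed as a relation from $G$ to $H$; write $R(g)=\{h:(h,g)\in R\}$ and $R^{-1}(h)=\{g:(h,g)\in R\}$; $(c,a)\in Q\circ R$ iff $(c,b)\in Q$ and $(b,a)\in R$ for some $b$. $R$ is: edge-preserving if $(h,g),(h',g')\in R$ and $g\sqcap g'$ imply $h\sqcap h'$; co-surjective if $R(g)\neq\emptyset$ for all $g\in G$; co-injective if for all $h\in H$ there is $g\in G$ with $R(g)=\{h\}$; co-bijective if co-injective and co-surjective; edge-witnessing if $h\sqcap h'$ implies there is $g$ with $(h,g),(h',g)\in R$; star-refining if for all $g\in G$ there is $h\in H$ with $\{g':g'\sqcap g\}\subseteq R^{-1}(h)$. $\mathbf{B}$ is the category of graphs with co-bijective edge-preserving relations as morphisms. $\mathbf{C}^H_G$ denotes the set of morphisms of $\mathbf C$ from $G$ to $H$. Sequences. A sequence in $\mathbf{C}$ is a family $(G_n,R^m_n)_{m\le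 n\in\omega}$ with $R^m_n\in\mathbf{C}^{G_m}_{G_n}$, $R^n_n$ the identity and $R^l_m\circ R^m_n=R^l_n$ for $l\le m\le n$. It has a property of morphisms (e.g. edge-witnessing) if $R^m_n$ has it for all $m<n$. A subsequence is $(G_{\phi(n)},R^{\phi(m)}_{\phi(n)})$ for a strictly increasing $\phi:\omega\to\omega$. A sequence in $\mathbf{C}$ is Fraïssé (resp. lax-Fraïssé) if it is cofinal, i.e. for every object $G$ of $\mathbf{C}$ some $\mathbf{C}^G_{G_n}$ is non-empty, and for every $m$ and $T\in\mathbf{C}^{G_m}_G$ there are $n\ge m$ and $T'\in\mathbf{C}^G_{G_n}$ with $T\circ T'=R^m_n$ (resp. $T\circ T'\subseteq R^m_n$). Induced poset and spectrum. The induced poset of a sequence is the disjoint union $\mathbb{P}=\bigsqcup_nG_n$, where for $p\in G_n$, $q\in G_m$, $p\le q$ iff $m\le n$ and $(q,p)\in R^m_n$. In a poset $\mathbb{P}$, a band is a finite $B\subseteq\mathbb{P}$ such that every element of $\mathbb{P}$ is comparable to an element of $B$; a cap is a set $C\subseteq\mathbb P$ for which there is a band $B$ such that each $b\in B$ is $\le$ some $c\in C$; a selector is a subset of $\mathbb{P}$ meeting every cap. The spectrum $\mathsf{S}\mathbb{P}$ is the set of minimal selectors (with respect to inclusion) with the topology generated by the sets $p^\in=\{S\in\mathsf{S}\mathbb{P}:p\in S\}$, $p\in\mathbb{P}$. *)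

theory Defs
  imports "HOL-Analysis.Analysis"
begin

section \<open>Graphs and relations between them\<close>

record 'a graph =
  verts :: "'a set"
  adj :: "'a rel"

definition is_graph :: "'a graph \<Rightarrow> bool" where
  "is_graph G \<longleftrightarrow>
     finite (verts G) \<and> verts G \<noteq> {} \<and> adj G \<subseteq> verts G \<times> verts G \<and>
     refl_on (verts G) (adj G) \<and> sym (adj G)"

text \<open>
  A relation from \<open>G\<close> to \<open>H\<close> is a subset of \<open>verts H \<times> verts G\<close>, with the target in the first
  coordinate. With this orientation \<open>Q O R\<close> is the composite "first \<open>R\<close>, then \<open>Q\<close>".
  In the predicates below, \<open>G\<close> is always the source and \<open>H\<close> the target.
\<close>

definition rel_img :: "'a rel \<Rightarrow> 'a \<Rightarrow> 'a set" where
  "rel_img R g = {h. (h, g) \<in> R}"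

definition rel_preimg :: "'a rel \<Rightarrow> 'a \<Rightarrow> 'a set" where
  "rel_preimg R h = {g. (h, g) \<in> R}"

definition edge_preserving :: "'a graph \<Rightarrow> 'a graph \<Rightarrow> 'a rel \<Rightarrow> bool" where
  "edge_preserving G H R \<longleftrightarrow>
     (\<forall>h g h' g'. (h, g) \<in> R \<longrightarrow> (h', g') \<in> R \<longrightarrow> (g, g') \<in> adj G \<longrightarrow> (h, h') \<in> adj H)"

definition co_surjective :: "'a graph \<Rightarrow> 'a graph \<Rightarrow> 'a rel \<Rightarrow> bool" where
  "co_surjective G H R \<longleftrightarrow> (\<forall>g\<in>verts G. rel_img R g \<noteq> {})"

definition co_injective :: "'a graph \<Rightarrow> 'a graph \<Rightarrow> 'a rel \<Rightarrow> bool" where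
  "co_injective G H R \<longleftrightarrow> (\<forall>h\<in>verts H. \<exists>g\<in>verts G. rel_img R g = {h})"

definition co_bijective :: "'a graph \<Rightarrow> 'a graph \<Rightarrow> 'a rel \<Rightarrow> bool" where
  "co_bijective G H R \<longleftrightarrow> co_injective G H R \<and> co_surjective G H R"

definition edge_witnessing :: "'a graph \<Rightarrow> 'a graph \<Rightarrow> 'a rel \<Rightarrow> bool" where
  "edge_witnessing G H R \<longleftrightarrow>
     (\<forall>h h'. (h, h') \<in> adj H \<longrightarrow> (\<exists>g\<in>verts G. (h, g) \<in> R \<and> (h', g) \<in> R))"

definition star_refining :: "'a graph \<Rightarrow> 'a graph \<Rightarrow> 'a rel \<Rightarrow> bool" where
  "star_refining G H R \<longleftrightarrow>
     (\<forall>g\<in>verts G. \<exists>h\<in>verts H. {g'. (g', g) \<in> adj G} \<subseteq> rel_preimg R h)"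


section \<open>The category \<open>\<^bold>B\<close> and its subcategories\<close>

definition B_mor :: "'a graph \<Rightarrow> 'a graph \<Rightarrow> 'a rel set" where
  "B_mor G H =
     {R. R \<subseteq> verts H \<times> verts G \<and> co_bijective G H R \<and> edge_preserving G H R}"

text \<open>
  A subcategory is given by its objects \<open>Ob\<close> and its hom-sets: \<open>Mor G H\<close> consists of the morphisms
  from \<open>G\<close> to \<open>H\<close>. It need be neither full nor closed under isomorphism.
  The values of \<open>Mor\<close> outside \<open>Ob\<close> are irrelevant.
\<close>

definition subcategory_of_B ::
    "'a graph set \<Rightarrow> ('a graph \<Rightarrow> 'a graph \<Rightarrow> 'a rel set) \<Rightarrow> bool" where
  "subcategory_of_B Ob Mor \<longleftrightarrow>
     (\<forall>G\<in>Ob. is_graph G) \<and>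
     (\<forall>G\<in>Ob. \<forall>H\<in>Ob. Mor G H \<subseteq> B_mor G H) \<and>
     (\<forall>G\<in>Ob. Id_on (verts G) \<in> Mor G G) \<and>
     (\<forall>G\<in>Ob. \<forall>H\<in>Ob. \<forall>K\<in>Ob. \<forall>R\<in>Mor G H. \<forall>Q\<in>Mor H K. Q O R \<in> Mor G K)"


section \<open>Sequences\<close>

text \<open>
  \<open>R m n\<close> is the bonding relation from \<open>G n\<close> to \<open>G m\<close>; its values for \<open>m > n\<close> are irrelevant.
\<close>

definition is_sequence ::
    "'a graph set \<Rightarrow> ('a graph \<Rightarrow> 'a graph \<Rightarrow> 'a rel set) \<Rightarrow>
     (nat \<Rightarrow> 'a graph) \<Rightarrow> (nat \<Rightarrow> nat \<Rightarrow> 'a rel) \<Rightarrow> bool" where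
  "is_sequence Ob Mor G R \<longleftrightarrow>
     (\<forall>n. G n \<in> Ob) \<and>
     (\<forall>m n. m \<le> n \<longrightarrow> R m n \<in> Mor (G n) (G m)) \<and>
     (\<forall>n. R n n = Id_on (verts (G n))) \<and>
     (\<forall>l m n. l \<le> m \<longrightarrow> m \<le> n \<longrightarrow> R l m O R m n = R l n)"

definition sequence_has ::
    "('a graph \<Rightarrow> 'a graph \<Rightarrow> 'a rel \<Rightarrow> bool) \<Rightarrow>
     (nat \<Rightarrow> 'a graph) \<Rightarrow> (nat \<Rightarrow> nat \<Rightarrow> 'a rel) \<Rightarrow> bool" where
  "sequence_has P G R \<longleftrightarrow> (\<forall>m n. m < n \<longrightarrow> P (G n) (G m) (R m n))"

definition has_edge_witnessing_star_refining_subsequence ::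
    "(nat \<Rightarrow> 'a graph) \<Rightarrow> (nat \<Rightarrow> nat \<Rightarrow> 'a rel) \<Rightarrow> bool" where
  "has_edge_witnessing_star_refining_subsequence G R \<longleftrightarrow>
     (\<exists>\<phi> :: nat \<Rightarrow> nat. strict_mono \<phi> \<and>
        sequence_has edge_witnessing (\<lambda>n. G (\<phi> n)) (\<lambda>m n. R (\<phi> m) (\<phi> n)) \<and>
        sequence_has star_refining (\<lambda>n. G (\<phi> n)) (\<lambda>m n. R (\<phi> m) (\<phi> n)))"

definition cofinal_sequence ::
    "'a graph set \<Rightarrow> ('a graph \<Rightarrow> 'a graph \<Rightarrow> 'a rel set) \<Rightarrow> (nat \<Rightarrow> 'a graph) \<Rightarrow> bool" where
  "cofinal_sequence Ob Mor G \<longleftrightarrow> (\<forall>K\<in>Ob. \<exists>n. Mor (G n) K \<noteq> {})"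

definition fraisse ::
    "'a graph set \<Rightarrow> ('a graph \<Rightarrow> 'a graph \<Rightarrow> 'a rel set) \<Rightarrow>
     (nat \<Rightarrow> 'a graph) \<Rightarrow> (nat \<Rightarrow> nat \<Rightarrow> 'a rel) \<Rightarrow> bool" where
  "fraisse Ob Mor G R \<longleftrightarrow>
     cofinal_sequence Ob Mor G \<and>
     (\<forall>m. \<forall>K\<in>Ob. \<forall>T\<in>Mor K (G m). \<exists>n\<ge>m. \<exists>T'\<in>Mor (G n) K. T O T' = R m n)"

definition lax_fraisse ::
    "'a graph set \<Rightarrow> ('a graph \<Rightarrow> 'a graph \<Rightarrow> 'a rel set) \<Rightarrow>
     (nat \<Rightarrow> 'a graph) \<Rightarrow> (nat \<Rightarrow> nat \<Rightarrow> 'a rel) \<Rightarrow> bool" where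
  "lax_fraisse Ob Mor G R \<longleftrightarrow>
     cofinal_sequence Ob Mor G \<and>
     (\<forall>m. \<forall>K\<in>Ob. \<forall>T\<in>Mor K (G m). \<exists>n\<ge>m. \<exists>T'\<in>Mor (G n) K. T O T' \<subseteq> R m n)"


section \<open>The spectrum of a poset\<close>

text \<open>
  A poset is a carrier \<open>P\<close> with an order \<open>r \<subseteq> P \<times> P\<close>, where \<open>(x, y) \<in> r\<close> means \<open>x \<le> y\<close>.
\<close>

definition band :: "'p set \<Rightarrow> 'p rel \<Rightarrow> 'p set \<Rightarrow> bool" where
  "band P r B \<longleftrightarrow> finite B \<and> B \<subseteq> P \<and> (\<forall>p\<in>P. \<exists>b\<in>B. (p, b) \<in> r \<or> (b, p) \<in> r)"

definition cap :: "'p set \<Rightarrow> 'p rel \<Rightarrow> 'p set \<Rightarrow> bool" where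
  "cap P r C \<longleftrightarrow> C \<subseteq> P \<and> (\<exists>B. band P r B \<and> (\<forall>b\<in>B. \<exists>c\<in>C. (b, c) \<in> r))"

definition selector :: "'p set \<Rightarrow> 'p rel \<Rightarrow> 'p set \<Rightarrow> bool" where
  "selector P r S \<longleftrightarrow> S \<subseteq> P \<and> (\<forall>C. cap P r C \<longrightarrow> S \<inter> C \<noteq> {})"

definition spectrum :: "'p set \<Rightarrow> 'p rel \<Rightarrow> 'p set set" where
  "spectrum P r = {S. selector P r S \<and> (\<forall>T. selector P r T \<longrightarrow> T \<subseteq> S \<longrightarrow> T = S)}"

text \<open>
  Including the whole spectrum among the generators implements the convention that the empty
  intersection of subbasic sets is the whole space, so that the underlying set is \<open>spectrum P r\<close>.
\<close>

definition spectrum_topology :: "'p set \<Rightarrow> 'p rel \<Rightarrow> 'p set topology" where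
  "spectrum_topology P r =
     topology_generated_by (insert (spectrum P r) {{S \<in> spectrum P r. p \<in> S} | p. p \<in> P})"


section \<open>The induced poset of a sequence\<close>

definition induced_carrier :: "(nat \<Rightarrow> 'a graph) \<Rightarrow> (nat \<times> 'a) set" where
  "induced_carrier G = (SIGMA n:UNIV. verts (G n))"

definition induced_order ::
    "(nat \<Rightarrow> 'a graph) \<Rightarrow> (nat \<Rightarrow> nat \<Rightarrow> 'a rel) \<Rightarrow> (nat \<times> 'a) rel" where
  "induced_order G R =
     {((n, p), (m, q)) | n p m q. p \<in> verts (G n) \<and> q \<in> verts (G m) \<and> m \<le> n \<and> (q, p) \<in> R m n}"

definition sequence_spectrum ::
    "(nat \<Rightarrow> 'a graph) \<Rightarrow> (nat \<Rightarrow> nat \<Rightarrow> 'a rel) \<Rightarrow> (nat \<times> 'a) set topology" where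
  "sequence_spectrum G R = spectrum_topology (induced_carrier G) (induced_order G R)"

end

theory Submission
  imports Defs
begin

text \<open>
  Since the levels of the induced poset are bands that refine every cap, the minimal selectors are
  the up-closed sets \<open>S\<close> that meet every level and are round: each \<open>x \<in> S\<close> lies above all of
  \<open>S\<close> at some level. Going back and forth gives morphisms \<open>T k\<close> and \<open>T' k\<close> that form a zigzag
  between the two sequences, commuting exactly in the Fraisse case and up to inclusion in the lax case.
  Both cases are treated at once through relations \<open>N n\<close> of nearness on the vertices: equality in the
  Fraisse case, adjacency in the lax case. A minimal selector \<open>S\<close> is sent to the set of
  those \<open>h\<close> which lie above everything \<open>N\<close>-near, in two steps, to some \<open>x\<close> with \<open>(x, p) \<in> T' k\<close> and
  \<open>p \<in> S\<close>. This set is the image of \<open>S\<close> under a fixed relation, so the map is continuous,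
  and by minimality it is enough to prove one inclusion for each of the two composites.
\<close>

section \<open>Relations inducing homeomorphisms of spectra\<close>

lemma topspace_spectrum_topology [simp]: "topspace (spectrum_topology P r) = spectrum P r"
  unfolding spectrum_topology_def by auto

lemma openin_spectrum_basic:
  assumes "p \<in> P"
  shows "openin (spectrum_topology P r) {S \<in> spectrum P r. p \<in> S}"
  unfolding spectrum_topology_def using assms by (intro topology_generated_by_Basis) auto

lemma continuous_map_spectrum_Image:
  assumes D: "\<And>S. S \<in> spectrum P r \<Longrightarrow> D `` S \<in> spectrum P' r'"
  shows "continuous_map (spectrum_topology P r) (spectrum_topology P' r') (\<lambda>S. D `` S)"
proof -
  let ?X = "spectrum_topology P r"
  have op: "openin ?X {S \<in> spectrum P r. q \<in> D `` S}" for q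
  proof -
    have "{S \<in> spectrum P r. q \<in> D `` S} = (\<Union>p\<in>{p\<in>P. (p, q) \<in> D}. {S \<in> spectrum P r. p \<in> S})"
      by (auto simp: spectrum_def selector_def)
    then show ?thesis by (auto intro!: openin_spectrum_basic)
  qed
  show ?thesis
    unfolding spectrum_topology_def[of P' r'] continuous_on_generated_topo_iff
  proof (intro conjI allI impI)
    fix U
    assume "U \<in> insert (spectrum P' r') {{S \<in> spectrum P' r'. p \<in> S} |p. p \<in> P'}"
    then consider "U = spectrum P' r'" | p where "U = {S \<in> spectrum P' r'. p \<in> S}" by auto
    then show "openin ?X ((\<lambda>S. D `` S) -` U \<inter> topspace ?X)"
    proof cases
      case 1
      then have "(\<lambda>S. D `` S) -` U \<inter> topspace ?X = topspace ?X" using D by auto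
      then show ?thesis by (metis openin_topspace)
    next
      case (2 p)
      then have "(\<lambda>S. D `` S) -` U \<inter> topspace ?X = {S \<in> spectrum P r. p \<in> D `` S}"
        using D by auto
      then show ?thesis using op by simp
    qed
  next
    show "(\<lambda>S. D `` S) ` topspace ?X \<subseteq> \<Union> (insert (spectrum P' r') {{S \<in> spectrum P' r'. p \<in> S} |p. p \<in> P'})"
      using D by auto
  qed
qed

lemma spectrum_subset_eq:
  assumes "S \<in> spectrum P r" "T \<in> spectrum P r" "T \<subseteq> S"
  shows "T = S"
  using assms unfolding spectrum_def by blast

lemma homeomorphic_spectra:
  assumes D: "\<And>S. S \<in> spectrum P r \<Longrightarrow> D `` S \<in> spectrum P' r'"
    and E: "\<And>S. S \<in> spectrum P' r' \<Longrightarrow> E `` S \<in> spectrum P r"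
    and ED: "\<And>S. S \<in> spectrum P r \<Longrightarrow> E `` (D `` S) \<subseteq> S"
    and DE: "\<And>S. S \<in> spectrum P' r' \<Longrightarrow> D `` (E `` S) \<subseteq> S"
  shows "spectrum_topology P r homeomorphic_space spectrum_topology P' r'"
proof -
  have "E `` (D `` S) = S" if "S \<in> spectrum P r" for S
    using that D E ED by (intro spectrum_subset_eq) auto
  moreover have "D `` (E `` S) = S" if "S \<in> spectrum P' r'" for S
    using that D E DE by (intro spectrum_subset_eq) auto
  ultimately have "homeomorphic_maps (spectrum_topology P r) (spectrum_topology P' r')
      (\<lambda>S. D `` S) (\<lambda>S. E `` S)"
    unfolding homeomorphic_maps_def
    by (auto intro!: continuous_map_spectrum_Image D E)
  then show ?thesis
    by (rule homeomorphic_maps_imp_homeomorphic_space)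
qed


section \<open>The spectrum of a sequence\<close>

lemma B_mor_image: "X \<in> B_mor K L \<Longrightarrow> g \<in> verts K \<Longrightarrow> \<exists>h. (h, g) \<in> X"
  unfolding B_mor_def co_bijective_def co_surjective_def rel_img_def by blast

lemma B_mor_preimage: "X \<in> B_mor K L \<Longrightarrow> h \<in> verts L \<Longrightarrow> \<exists>g\<in>verts K. (h, g) \<in> X"
  unfolding B_mor_def co_bijective_def co_injective_def rel_img_def by blast

lemma B_mor_verts: "X \<in> B_mor K L \<Longrightarrow> (h, g) \<in> X \<Longrightarrow> h \<in> verts L \<and> g \<in> verts K"
  unfolding B_mor_def by blast

lemma B_mor_edge:
  "X \<in> B_mor K L \<Longrightarrow> (h, g) \<in> X \<Longrightarrow> (h', g') \<in> X \<Longrightarrow> (g, g') \<in> adj K \<Longrightarrow> (h, h') \<in> adj L"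
  unfolding B_mor_def edge_preserving_def by blast

lemma Id_on_comp_B_mor: "X \<in> B_mor K L \<Longrightarrow> Id_on (verts L) O X = X"
  unfolding B_mor_def by blast

locale graph_sequence =
  fixes G :: "nat \<Rightarrow> 'a graph" and R :: "nat \<Rightarrow> nat \<Rightarrow> 'a rel"
  assumes graph: "is_graph (G n)"
    and mor: "m \<le> n \<Longrightarrow> R m n \<in> B_mor (G n) (G m)"
    and ident: "R n n = Id_on (verts (G n))"
    and comp: "l \<le> m \<Longrightarrow> m \<le> n \<Longrightarrow> R l m O R m n = R l n"
begin

abbreviation "P \<equiv> induced_carrier G"
abbreviation "r \<equiv> induced_order G R"

lemma mem_P [simp]: "(n, p) \<in> P \<longleftrightarrow> p \<in> verts (G n)"
  by (simp add: induced_carrier_def)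

lemma order_iff: "((n, p), (m, q)) \<in> r \<longleftrightarrow> m \<le> n \<and> (q, p) \<in> R m n"
  using B_mor_verts[OF mor] unfolding induced_order_def by blast

lemma order_verts: "(x, y) \<in> r \<Longrightarrow> x \<in> P \<and> y \<in> P"
  by (auto simp: induced_order_def)

lemma order_refl: "x \<in> P \<Longrightarrow> (x, x) \<in> r"
  by (cases x) (auto simp: order_iff ident)

lemma bond_trans: "(x, y) \<in> R l m \<Longrightarrow> (y, z) \<in> R m n \<Longrightarrow> l \<le> m \<Longrightarrow> m \<le> n \<Longrightarrow> (x, z) \<in> R l n"
  using comp by blast

lemma order_trans: "(x, y) \<in> r \<Longrightarrow> (y, z) \<in> r \<Longrightarrow> (x, z) \<in> r"
  by (cases x, cases y, cases z) (auto simp: order_iff intro: bond_trans)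

lemma above: "p \<in> verts (G n) \<Longrightarrow> m \<le> n \<Longrightarrow> \<exists>q. ((n, p), (m, q)) \<in> r"
  using B_mor_image[OF mor] by (auto simp: order_iff)

lemma band_level: "band P r (Pair n ` verts (G n))"
  unfolding band_def
proof (intro conjI ballI)
  show "finite (Pair n ` verts (G n))" using graph[of n] by (simp add: is_graph_def)
  show "Pair n ` verts (G n) \<subseteq> P" by auto
  fix x assume "x \<in> P"
  then obtain k p where x: "x = (k, p)" "p \<in> verts (G k)" by (cases x) auto
  show "\<exists>b\<in>Pair n ` verts (G n). (x, b) \<in> r \<or> (b, x) \<in> r"
  proof (cases "n \<le> k")
    case True
    then show ?thesis using above[OF x(2) True] x order_verts by fastforce
  next
    case False
    then show ?thesis using B_mor_preimage[OF mor[of k n] x(2)] x by (auto simp: order_iff)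
  qed
qed

lemma cap_iff:
  "cap P r C \<longleftrightarrow> C \<subseteq> P \<and> (\<exists>n. \<forall>p\<in>verts (G n). \<exists>c\<in>C. ((n, p), c) \<in> r)"
proof
  assume "cap P r C"
  then obtain B where C: "C \<subseteq> P" and B: "band P r B" "\<forall>b\<in>B. \<exists>c\<in>C. (b, c) \<in> r"
    unfolding cap_def by blast
  have fin: "finite (fst ` B)" using B by (simp add: band_def)
  define n where "n = Suc (Max (fst ` B))"
  have less: "fst b < n" if "b \<in> B" for b
    using Max_ge[OF fin, of "fst b"] that by (simp add: n_def)
  have "\<exists>c\<in>C. ((n, p), c) \<in> r" if p: "p \<in> verts (G n)" for p
  proof -
    obtain b where b: "b \<in> B" "((n, p), b) \<in> r \<or> (b, (n, p)) \<in> r"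
      using B(1) p unfolding band_def by (metis mem_P)
    have "(b, (n, p)) \<notin> r" using less[OF b(1)] by (cases b) (auto simp: order_iff)
    then show ?thesis using b B(2) order_trans by blast
  qed
  then show "C \<subseteq> P \<and> (\<exists>n. \<forall>p\<in>verts (G n). \<exists>c\<in>C. ((n, p), c) \<in> r)" using C by blast
next
  assume "C \<subseteq> P \<and> (\<exists>n. \<forall>p\<in>verts (G n). \<exists>c\<in>C. ((n, p), c) \<in> r)"
  then show "cap P r C"
    unfolding cap_def using band_level by blast
qed

lemma cap_level: "cap P r (Pair n ` verts (G n))"
  unfolding cap_iff using order_refl mem_P by blast

definition round_selector :: "(nat \<times> 'a) set \<Rightarrow> bool" where
  "round_selector S \<longleftrightarrow> S \<subseteq> P \<and> (\<forall>x y. x \<in> S \<longrightarrow> (x, y) \<in> r \<longrightarrow> y \<in> S) \<and>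
     (\<forall>n. \<exists>p. (n, p) \<in> S) \<and> (\<forall>x\<in>S. \<exists>n. \<forall>p. (n, p) \<in> S \<longrightarrow> ((n, p), x) \<in> r)"

lemma round_selectorD:
  assumes "round_selector S"
  shows "S \<subseteq> P" "\<And>x y. x \<in> S \<Longrightarrow> (x, y) \<in> r \<Longrightarrow> y \<in> S" "\<exists>p. (n, p) \<in> S"
    "\<And>x. x \<in> S \<Longrightarrow> \<exists>n. \<forall>p. (n, p) \<in> S \<longrightarrow> ((n, p), x) \<in> r"
  using assms unfolding round_selector_def by blast+

lemma spectrum_iff: "S \<in> spectrum P r \<longleftrightarrow> round_selector S"
proof
  assume S: "S \<in> spectrum P r"
  then have sel: "selector P r S" and min: "\<And>T. selector P r T \<Longrightarrow> T \<subseteq> S \<Longrightarrow> T = S"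
    unfolding spectrum_def by auto
  have private_cap: "\<exists>C. cap P r C \<and> S \<inter> C = {x}" if x: "x \<in> S" for x
  proof -
    have "\<not> selector P r (S - {x})" using min[of "S - {x}"] x by blast
    then obtain C where C: "cap P r C" "(S - {x}) \<inter> C = {}"
      using sel unfolding selector_def by blast
    moreover have "S \<inter> C \<noteq> {}" using sel C unfolding selector_def by blast
    ultimately show ?thesis by blast
  qed
  have up: "y \<in> S" if xy: "x \<in> S" "(x, y) \<in> r" for x y
  proof -
    obtain C where C: "cap P r C" "S \<inter> C = {x}" using private_cap xy by blast
    obtain n where n: "C \<subseteq> P" "\<forall>p\<in>verts (G n). \<exists>c\<in>C. ((n, p), c) \<in> r"
      using C(1) unfolding cap_iff by blast
    have "cap P r (insert y (C - {x}))"
      unfolding cap_iff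
    proof (intro conjI exI ballI)
      show "insert y (C - {x}) \<subseteq> P" using n order_verts[OF xy(2)] by blast
      fix p assume "p \<in> verts (G n)"
      then obtain c where "c \<in> C" "((n, p), c) \<in> r" using n by blast
      then show "\<exists>c\<in>insert y (C - {x}). ((n, p), c) \<in> r"
        using xy(2) order_trans[of "(n, p)" x y] by (cases "c = x") auto
    qed
    then have "S \<inter> insert y (C - {x}) \<noteq> {}" using sel unfolding selector_def by blast
    then show ?thesis using C by blast
  qed
  have "\<exists>n. \<forall>p. (n, p) \<in> S \<longrightarrow> ((n, p), x) \<in> r" if x: "x \<in> S" for x
  proof -
    obtain C where C: "cap P r C" "S \<inter> C = {x}" using private_cap x by blast
    obtain n where n: "\<forall>p\<in>verts (G n). \<exists>c\<in>C. ((n, p), c) \<in> r"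
      using C(1) unfolding cap_iff by blast
    have "((n, p), x) \<in> r" if p: "(n, p) \<in> S" for p
    proof -
      have "p \<in> verts (G n)" using p sel unfolding selector_def by auto
      then obtain c where "c \<in> C" "((n, p), c) \<in> r" using n by blast
      moreover from this have "c \<in> S \<inter> C" using up[OF p] by simp
      ultimately show ?thesis using C(2) by simp
    qed
    then show ?thesis by blast
  qed
  moreover have "\<exists>p. (n, p) \<in> S" for n
    using sel cap_level[of n] unfolding selector_def by blast
  moreover have "S \<subseteq> P" using sel unfolding selector_def by blast
  ultimately show "round_selector S"
    unfolding round_selector_def by (intro conjI allI impI ballI) (assumption | rule up)+
next
  assume S: "round_selector S"
  have "selector P r S"
    unfolding selector_def
  proof (intro conjI allI impI)
    show "S \<subseteq> P" by (rule round_selectorD(1)[OF S])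
    fix C assume "cap P r C"
    then obtain n where n: "\<forall>p\<in>verts (G n). \<exists>c\<in>C. ((n, p), c) \<in> r"
      unfolding cap_iff by blast
    obtain p where p: "(n, p) \<in> S" using round_selectorD(3)[OF S] ..
    then have "p \<in> verts (G n)" using round_selectorD(1)[OF S] by auto
    then obtain c where "c \<in> C" "((n, p), c) \<in> r" using n by blast
    moreover from this have "c \<in> S" using round_selectorD(2)[OF S p] by simp
    ultimately show "S \<inter> C \<noteq> {}" by blast
  qed
  moreover have "S \<subseteq> T" if T: "selector P r T" "T \<subseteq> S" for T
  proof
    fix x assume x: "x \<in> S"
    then obtain n where n: "\<And>p. (n, p) \<in> S \<Longrightarrow> ((n, p), x) \<in> r"
      using round_selectorD(4)[OF S] by metis
    have "cap P r (insert x (Pair n ` verts (G n) - S))"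
      unfolding cap_iff
    proof (intro conjI exI ballI)
      show "insert x (Pair n ` verts (G n) - S) \<subseteq> P"
        using x round_selectorD(1)[OF S] by auto
      fix p assume "p \<in> verts (G n)"
      then show "\<exists>c\<in>insert x (Pair n ` verts (G n) - S). ((n, p), c) \<in> r"
        using n order_refl[of "(n, p)"] by (cases "(n, p) \<in> S") (auto intro!: bexI[of _ "(n, p)"])
    qed
    then show "x \<in> T" using T unfolding selector_def by blast
  qed
  ultimately show "S \<in> spectrum P r" unfolding spectrum_def by blast
qed

lemma round_selector_eventually:
  assumes S: "round_selector S" and x: "x \<in> S"
  shows "\<exists>n. \<forall>k\<ge>n. \<forall>p. (k, p) \<in> S \<longrightarrow> ((k, p), x) \<in> r"
proof -
  obtain n where n: "\<forall>p. (n, p) \<in> S \<longrightarrow> ((n, p), x) \<in> r"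
    using round_selectorD(4)[OF S x] ..
  have "((k, p), x) \<in> r" if k: "k \<ge> n" "(k, p) \<in> S" for k p
  proof -
    have "p \<in> verts (G k)" using k round_selectorD(1)[OF S] by auto
    then obtain q where q: "((k, p), (n, q)) \<in> r" using above[OF _ k(1)] by blast
    have "(n, q) \<in> S" by (rule round_selectorD(2)[OF S k(2) q])
    then have "((n, q), x) \<in> r" using n by simp
    then show ?thesis by (rule order_trans[OF q])
  qed
  then show ?thesis by auto
qed

end


section \<open>Nearness relations\<close>

definition lifts :: "'a rel \<Rightarrow> 'a rel \<Rightarrow> 'a rel \<Rightarrow> bool" where
  "lifts N M X \<longleftrightarrow> (\<forall>p p' x. (p, p') \<in> N \<longrightarrow> (x, p) \<in> X \<longrightarrow> (\<exists>x'. (x', p') \<in> X \<and> (x, x') \<in> M))"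

lemma liftsD: "lifts N M X \<Longrightarrow> (p, p') \<in> N \<Longrightarrow> (x, p) \<in> X \<Longrightarrow> \<exists>x'. (x', p') \<in> X \<and> (x, x') \<in> M"
  unfolding lifts_def by blast

lemma lifts_adj:
  assumes "X \<in> B_mor K L" "is_graph K"
  shows "lifts (adj K) (adj L) X"
  unfolding lifts_def
proof (intro allI impI)
  fix p p' x assume *: "(p, p') \<in> adj K" "(x, p) \<in> X"
  then have "p' \<in> verts K" using assms by (auto simp: is_graph_def)
  then obtain x' where x': "(x', p') \<in> X" using B_mor_image[OF assms(1)] by blast
  then show "\<exists>x'. (x', p') \<in> X \<and> (x, x') \<in> adj L"
    using B_mor_edge[OF assms(1) *(2) x' *(1)] by blast
qed

lemma lifts_Id_on:
  assumes "X \<in> B_mor K L"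
  shows "lifts (Id_on (verts K)) (Id_on (verts L)) X"
  using B_mor_verts[OF assms] by (auto simp: lifts_def)

locale near_sequence = graph_sequence +
  fixes N :: "nat \<Rightarrow> 'a rel"
  assumes near_refl: "p \<in> verts (G n) \<Longrightarrow> (p, p) \<in> N n"
    and near_sym: "(p, q) \<in> N n \<Longrightarrow> (q, p) \<in> N n"
    and near_bond: "m \<le> n \<Longrightarrow> lifts (N n) (N m) (R m n)"
    and near_fine: "\<exists>n\<ge>l. \<forall>k\<ge>n. \<forall>x\<in>verts (G k). \<exists>h. \<forall>y. (x, y) \<in> N k O N k \<longrightarrow> (h, y) \<in> R l k"

context graph_sequence
begin

lemma near_sequence_Id: "near_sequence G R (\<lambda>n. Id_on (verts (G n)))"
proof unfold_locales
  show "lifts (Id_on (verts (G n))) (Id_on (verts (G m))) (R m n)" if "m \<le> n" for m n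
    by (rule lifts_Id_on[OF mor[OF that]])
  show "\<exists>n\<ge>l. \<forall>k\<ge>n. \<forall>x\<in>verts (G k). \<exists>h. \<forall>y.
      (x, y) \<in> Id_on (verts (G k)) O Id_on (verts (G k)) \<longrightarrow> (h, y) \<in> R l k" for l
  proof (intro exI[of _ l] conjI allI impI ballI)
    fix k x assume k: "l \<le> k" and x: "x \<in> verts (G k)"
    have "\<exists>h. (h, x) \<in> R l k" by (rule B_mor_image[OF mor[OF k] x])
    then show "\<exists>h. \<forall>y. (x, y) \<in> Id_on (verts (G k)) O Id_on (verts (G k)) \<longrightarrow> (h, y) \<in> R l k"
      by blast
  qed simp
qed auto

lemma near_sequence_adj:
  assumes "has_edge_witnessing_star_refining_subsequence G R"
  shows "near_sequence G R (\<lambda>n. adj (G n))"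
proof unfold_locales
  show refl: "(p, p) \<in> adj (G n)" if "p \<in> verts (G n)" for n p
    using graph[of n] that by (auto simp: is_graph_def refl_on_def)
  show symm: "(q, p) \<in> adj (G n)" if "(p, q) \<in> adj (G n)" for n p q
    using graph[of n] that by (auto simp: is_graph_def sym_def)
  show lift: "lifts (adj (G n)) (adj (G m)) (R m n)" if "m \<le> n" for m n
    by (rule lifts_adj[OF mor[OF that] graph])
  obtain \<phi> :: "nat \<Rightarrow> nat" where mono: "strict_mono \<phi>"
    and star: "sequence_has star_refining (\<lambda>n. G (\<phi> n)) (\<lambda>m n. R (\<phi> m) (\<phi> n))"
    using assms unfolding has_edge_witnessing_star_refining_subsequence_def by blast
  have ref: "\<exists>h\<in>verts (G (\<phi> i)). \<forall>y. (y, x) \<in> adj (G (\<phi> j)) \<longrightarrow> (h, y) \<in> R (\<phi> i) (\<phi> j)"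
    if "i < j" "x \<in> verts (G (\<phi> j))" for i j x
    using star that unfolding sequence_has_def star_refining_def rel_preimg_def by blast
  fix l
  have le: "l \<le> \<phi> l" "\<phi> l \<le> \<phi> (Suc l)" "\<phi> (Suc l) \<le> \<phi> (Suc (Suc l))"
    using mono by (auto simp: strict_mono_imp_increasing strict_mono_less_eq)
  show "\<exists>n\<ge>l. \<forall>k\<ge>n. \<forall>x\<in>verts (G k). \<exists>h. \<forall>y.
      (x, y) \<in> adj (G k) O adj (G k) \<longrightarrow> (h, y) \<in> R l k"
  proof (intro exI[of _ "\<phi> (Suc (Suc l))"] conjI allI impI ballI)
    show "l \<le> \<phi> (Suc (Suc l))" using le by linarith
    fix k x assume k: "\<phi> (Suc (Suc l)) \<le> k" and x: "x \<in> verts (G k)"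
    obtain x2 where x2: "(x2, x) \<in> R (\<phi> (Suc (Suc l))) k" using B_mor_image[OF mor[OF k] x] by blast
    then have "x2 \<in> verts (G (\<phi> (Suc (Suc l))))" using B_mor_verts[OF mor[OF k]] by blast
    then obtain x1 where x1: "x1 \<in> verts (G (\<phi> (Suc l)))"
      "\<And>y. (y, x2) \<in> adj (G (\<phi> (Suc (Suc l)))) \<Longrightarrow> (x1, y) \<in> R (\<phi> (Suc l)) (\<phi> (Suc (Suc l)))"
      using ref[of "Suc l" "Suc (Suc l)" x2] by blast
    then obtain x0 where x0: "x0 \<in> verts (G (\<phi> l))"
      "\<And>y. (y, x1) \<in> adj (G (\<phi> (Suc l))) \<Longrightarrow> (x0, y) \<in> R (\<phi> l) (\<phi> (Suc l))"
      using ref[of l "Suc l" x1] by blast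
    then obtain h where h: "(h, x0) \<in> R l (\<phi> l)" using B_mor_image[OF mor[OF le(1)] x0(1)] by blast
    have "(h, y) \<in> R l k" if xz: "(x, z) \<in> adj (G k)" and zy: "(z, y) \<in> adj (G k)" for y z
    proof -
      obtain z2 where z2: "(z2, z) \<in> R (\<phi> (Suc (Suc l))) k" "(x2, z2) \<in> adj (G (\<phi> (Suc (Suc l))))"
        using liftsD[OF lift[OF k] xz x2] by blast
      obtain y2 where y2: "(y2, y) \<in> R (\<phi> (Suc (Suc l))) k" "(z2, y2) \<in> adj (G (\<phi> (Suc (Suc l))))"
        using liftsD[OF lift[OF k] zy z2(1)] by blast
      have "(x1, z2) \<in> R (\<phi> (Suc l)) (\<phi> (Suc (Suc l)))" by (rule x1(2)[OF symm[OF z2(2)]])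
      then obtain y1 where y1: "(y1, y2) \<in> R (\<phi> (Suc l)) (\<phi> (Suc (Suc l)))" "(x1, y1) \<in> adj (G (\<phi> (Suc l)))"
        using liftsD[OF lift[OF le(3)] y2(2)] by blast
      have "(y1, y) \<in> R (\<phi> (Suc l)) k" by (rule bond_trans[OF y1(1) y2(1) le(3) k])
      moreover have "(x0, y1) \<in> R (\<phi> l) (\<phi> (Suc l))" by (rule x0(2)[OF symm[OF y1(2)]])
      then have "(h, y1) \<in> R l (\<phi> (Suc l))" by (rule bond_trans[OF h _ le(1,2)])
      ultimately show ?thesis using bond_trans le k by (meson order.trans)
    qed
    then show "\<exists>h. \<forall>y. (x, y) \<in> adj (G k) O adj (G k) \<longrightarrow> (h, y) \<in> R l k" by blast
  qed
qed

end


section \<open>Zigzags commuting up to nearness\<close>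

text \<open>The nearness is squared because the roundness of the image of a selector
  accumulates one error along the relations \<open>X\<close> and one from the failure of commutation.\<close>

definition transfer ::
    "(nat \<Rightarrow> nat \<Rightarrow> 'a rel) \<Rightarrow> (nat \<Rightarrow> 'a rel) \<Rightarrow> (nat \<Rightarrow> nat) \<Rightarrow> (nat \<Rightarrow> nat) \<Rightarrow> (nat \<Rightarrow> 'a rel) \<Rightarrow>
     ((nat \<times> 'a) \<times> (nat \<times> 'a)) set" where
  "transfer Q M a b X = {((a k, p), (l, h)) | k p l h. l \<le> b k \<and>
     (\<exists>x. (x, p) \<in> X k \<and> (\<forall>y. (x, y) \<in> M (b k) O M (b k) \<longrightarrow> (h, y) \<in> Q l (b k)))}"

lemma mem_transfer_Image:
  "(l, h) \<in> transfer Q M a b X `` S \<longleftrightarrow> (\<exists>k p x. (a k, p) \<in> S \<and> l \<le> b k \<and> (x, p) \<in> X k \<and>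
     (\<forall>y. (x, y) \<in> M (b k) O M (b k) \<longrightarrow> (h, y) \<in> Q l (b k)))"
  unfolding transfer_def Image_iff mem_Collect_eq prod.inject by blast

locale zigzag = dom: near_sequence G R N + cod: near_sequence H Q M
  for G :: "nat \<Rightarrow> 'a graph" and R N and H :: "nat \<Rightarrow> 'a graph" and Q M +
  fixes a b :: "nat \<Rightarrow> nat" and T T' :: "nat \<Rightarrow> 'a rel"
  assumes mono: "strict_mono a" "strict_mono b"
    and T: "T k \<in> B_mor (H (b k)) (G (a k))"
    and T': "T' k \<in> B_mor (G (a (Suc k))) (H (b k))"
    and lifts_T: "lifts (M (b k)) (N (a k)) (T k)"
    and lifts_T': "lifts (N (a (Suc k))) (M (b k)) (T' k)"
    and dom_near: "k \<le> j \<Longrightarrow> (q, y) \<in> T k \<Longrightarrow> (y, x) \<in> Q (b k) (b j) \<Longrightarrow> (x, s) \<in> T' j \<Longrightarrow>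
      \<exists>q'. (q', s) \<in> R (a k) (a (Suc j)) \<and> (q, q') \<in> N (a k)"
    and cod_near: "k \<le> j \<Longrightarrow> (y, q) \<in> T' k \<Longrightarrow> (q, s) \<in> R (a (Suc k)) (a (Suc j)) \<Longrightarrow> (s, x) \<in> T (Suc j) \<Longrightarrow>
      \<exists>y'. (y', x) \<in> Q (b k) (b (Suc j)) \<and> (y, y') \<in> M (b k)"
begin

lemma swap: "zigzag H Q M G R N b (a \<circ> Suc) T' (T \<circ> Suc)"
proof unfold_locales
  show "strict_mono (a \<circ> Suc)" using mono by (auto simp: strict_mono_def)
  show "\<exists>q'. (q', s) \<in> Q (b k) (b (Suc j)) \<and> (q, q') \<in> M (b k)"
    if "k \<le> j" "(q, y) \<in> T' k" "(y, x) \<in> R ((a \<circ> Suc) k) ((a \<circ> Suc) j)" "(x, s) \<in> (T \<circ> Suc) j"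
    for k j q y x s
    using cod_near that by simp
  show "\<exists>y'. (y', x) \<in> R ((a \<circ> Suc) k) ((a \<circ> Suc) (Suc j)) \<and> (y, y') \<in> N ((a \<circ> Suc) k)"
    if "k \<le> j" "(y, q) \<in> (T \<circ> Suc) k" "(q, s) \<in> Q (b (Suc k)) (b (Suc j))" "(s, x) \<in> T' (Suc j)"
    for k j q y x s
    using dom_near[of "Suc k" "Suc j" y q s x] that by simp
qed (use mono T T' lifts_T lifts_T' in auto)

abbreviation "D \<equiv> transfer Q M (a \<circ> Suc) b T'"
abbreviation "E \<equiv> transfer R N b a T"

lemma mem_D:
  "(l, h) \<in> D `` S \<longleftrightarrow> (\<exists>k p x. (a (Suc k), p) \<in> S \<and> l \<le> b k \<and> (x, p) \<in> T' k \<and>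
     (\<forall>y. (x, y) \<in> M (b k) O M (b k) \<longrightarrow> (h, y) \<in> Q l (b k)))"
  by (simp only: mem_transfer_Image o_apply)

lemma mem_E:
  "(l, h) \<in> E `` S \<longleftrightarrow> (\<exists>k p x. (b k, p) \<in> S \<and> l \<le> a k \<and> (x, p) \<in> T k \<and>
     (\<forall>y. (x, y) \<in> N (a k) O N (a k) \<longrightarrow> (h, y) \<in> R l (a k)))"
  by (rule mem_transfer_Image)

lemma D_witness:
  assumes "(l, h) \<in> D `` S"
  obtains k p x where "(a (Suc k), p) \<in> S" "l \<le> b k" "(x, p) \<in> T' k" "(h, x) \<in> Q l (b k)"
proof -
  obtain k p x where *: "(a (Suc k), p) \<in> S" "l \<le> b k" "(x, p) \<in> T' k"
    "\<forall>y. (x, y) \<in> M (b k) O M (b k) \<longrightarrow> (h, y) \<in> Q l (b k)"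
    using assms[unfolded mem_D] by blast
  have "(x, x) \<in> M (b k)" using B_mor_verts[OF T' *(3)] cod.near_refl by blast
  then have "(h, x) \<in> Q l (b k)" using *(4) by blast
  then show thesis using that[OF *(1-3)] by blast
qed

lemma D_spectrum:
  assumes "S \<in> spectrum dom.P dom.r"
  shows "D `` S \<in> spectrum cod.P cod.r"
proof -
  have S: "dom.round_selector S" using assms by (simp only: dom.spectrum_iff)
  note SP = dom.round_selectorD(1)[OF S] and up = dom.round_selectorD(2)[OF S]
    and ne = dom.round_selectorD(3)[OF S]
  have "cod.round_selector (D `` S)"
    unfolding cod.round_selector_def
  proof (intro conjI allI impI ballI)
    show "D `` S \<subseteq> cod.P"
    proof
      fix z assume z: "z \<in> D `` S"
      obtain l h where zlh: "z = (l, h)" by (cases z)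
      obtain k x where k: "l \<le> b k" "(h, x) \<in> Q l (b k)"
        by (rule D_witness[OF z[unfolded zlh]])
      show "z \<in> cod.P" using B_mor_verts[OF cod.mor[OF k(1)] k(2)] zlh by simp
    qed
  next
    fix z w assume "z \<in> D `` S" "(z, w) \<in> cod.r"
    moreover obtain l h i g where zw: "z = (l, h)" "w = (i, g)" by (cases z, cases w)
    ultimately have *: "(l, h) \<in> D `` S" "i \<le> l" "(g, h) \<in> Q i l" by (auto simp: cod.order_iff)
    from *(1)[unfolded mem_D] obtain k p x where k: "(a (Suc k), p) \<in> S" "l \<le> b k" "(x, p) \<in> T' k"
      "\<forall>y. (x, y) \<in> M (b k) O M (b k) \<longrightarrow> (h, y) \<in> Q l (b k)"
      by blast
    have "\<forall>y. (x, y) \<in> M (b k) O M (b k) \<longrightarrow> (g, y) \<in> Q i (b k)"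
      using k(4) cod.bond_trans[OF *(3) _ *(2) k(2)] by simp
    moreover have "i \<le> b k" using *(2) k(2) by linarith
    ultimately show "w \<in> D `` S" unfolding zw mem_D using k(1,3) by blast
  next
    fix l
    obtain n where n: "n \<ge> l"
      "\<forall>k\<ge>n. \<forall>x\<in>verts (H k). \<exists>h. \<forall>y. (x, y) \<in> M k O M k \<longrightarrow> (h, y) \<in> Q l k"
      using cod.near_fine[of l] by blast
    have bn: "b n \<ge> n" using mono strict_mono_imp_increasing by blast
    obtain p where p: "(a (Suc n), p) \<in> S" using ne by blast
    then have "p \<in> verts (G (a (Suc n)))" using SP by auto
    then obtain x where x: "(x, p) \<in> T' n" using B_mor_image[OF T'] by blast
    then have "x \<in> verts (H (b n))" using B_mor_verts[OF T'] by blast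
    then obtain h where "\<forall>y. (x, y) \<in> M (b n) O M (b n) \<longrightarrow> (h, y) \<in> Q l (b n)"
      using n(2) bn by blast
    moreover have "l \<le> b n" using bn n(1) by linarith
    ultimately have "(l, h) \<in> D `` S" unfolding mem_D using p x by blast
    then show "\<exists>h. (l, h) \<in> D `` S" by blast
  next
    fix z assume z: "z \<in> D `` S"
    obtain l h where zlh: "z = (l, h)" by (cases z)
    obtain k p x where k: "(a (Suc k), p) \<in> S" "l \<le> b k" "(x, p) \<in> T' k"
      "\<forall>y. (x, y) \<in> M (b k) O M (b k) \<longrightarrow> (h, y) \<in> Q l (b k)"
      using z[unfolded zlh mem_D] by blast
    obtain n where n: "\<forall>i\<ge>n. \<forall>q. (i, q) \<in> S \<longrightarrow> ((i, q), (a (Suc k), p)) \<in> dom.r"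
      using dom.round_selector_eventually[OF S k(1)] ..
    define i where "i = max k n"
    have i: "k \<le> i" "a (Suc i) \<ge> n" "a (Suc k) \<le> a (Suc i)" "b k \<le> b (Suc i)"
      using strict_mono_imp_increasing[OF mono(1), of "Suc i"]
        strict_mono_less_eq[OF mono(1)] strict_mono_less_eq[OF mono(2)]
      by (auto simp: i_def)
    have "((b (Suc i), h'), z) \<in> cod.r" if h': "(b (Suc i), h') \<in> D `` S" for h'
    proof -
      obtain j s x' where j: "(a (Suc j), s) \<in> S" "b (Suc i) \<le> b j" "(x', s) \<in> T' j"
        "(h', x') \<in> Q (b (Suc i)) (b j)"
        by (rule D_witness[OF h'])
      have ij: "Suc i \<le> j" using j(2) strict_mono_less_eq[OF mono(2)] by blast
      have "h' \<in> verts (H (b (Suc i)))" using B_mor_verts[OF cod.mor[OF j(2)] j(4)] by blast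
      then obtain y where y: "(y, h') \<in> T (Suc i)" using B_mor_image[OF T] by blast
      obtain y' where y': "(y', s) \<in> R (a (Suc i)) (a (Suc j))" "(y, y') \<in> N (a (Suc i))"
        using dom_near[OF ij y j(4,3)] by blast
      have "a (Suc i) \<le> a (Suc j)" using ij strict_mono_less_eq[OF mono(1)] by simp
      then have "(a (Suc i), y') \<in> S" using up[OF j(1)] y'(1) by (simp add: dom.order_iff)
      then have "(p, y') \<in> R (a (Suc k)) (a (Suc i))" using n i(2) by (simp add: dom.order_iff)
      then obtain y1 where y1: "(y1, y) \<in> R (a (Suc k)) (a (Suc i))" "(p, y1) \<in> N (a (Suc k))"
        using liftsD[OF dom.near_bond[OF i(3)] dom.near_sym[OF y'(2)]] by blast
      obtain x1 where x1: "(x1, y1) \<in> T' k" "(x, x1) \<in> M (b k)"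
        using liftsD[OF lifts_T' y1(2) k(3)] by blast
      obtain x2 where x2: "(x2, h') \<in> Q (b k) (b (Suc i))" "(x1, x2) \<in> M (b k)"
        using cod_near[OF i(1) x1(1) y1(1) y] by blast
      have "(h, x2) \<in> Q l (b k)" using k(4) x1(2) x2(2) by blast
      then have "(h, h') \<in> Q l (b (Suc i))" by (rule cod.bond_trans[OF _ x2(1) k(2) i(4)])
      then show ?thesis using zlh k(2) i(4) by (simp add: cod.order_iff)
    qed
    then show "\<exists>n. \<forall>p. (n, p) \<in> D `` S \<longrightarrow> ((n, p), z) \<in> cod.r" by blast
  qed
  then show ?thesis by (simp only: cod.spectrum_iff)
qed

lemma E_D_subset:
  assumes "S \<in> spectrum dom.P dom.r"
  shows "E `` (D `` S) \<subseteq> S"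
proof
  fix z assume z: "z \<in> E `` (D `` S)"
  note up = dom.round_selectorD(2)[OF assms[unfolded dom.spectrum_iff]]
  obtain l p where zlp: "z = (l, p)" by (cases z)
  obtain k h q where k: "(b k, h) \<in> D `` S" "l \<le> a k" "(q, h) \<in> T k"
    "\<forall>y. (q, y) \<in> N (a k) O N (a k) \<longrightarrow> (p, y) \<in> R l (a k)"
    using z[unfolded zlp mem_E] by blast
  obtain j s x where j: "(a (Suc j), s) \<in> S" "b k \<le> b j" "(x, s) \<in> T' j" "(h, x) \<in> Q (b k) (b j)"
    by (rule D_witness[OF k(1)])
  have kj: "k \<le> j" using j(2) strict_mono_less_eq[OF mono(2)] by blast
  obtain q' where q': "(q', s) \<in> R (a k) (a (Suc j))" "(q, q') \<in> N (a k)"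
    using dom_near[OF kj k(3) j(4,3)] by blast
  have le: "a k \<le> a (Suc j)" using kj strict_mono_less_eq[OF mono(1)] by simp
  have "q' \<in> verts (G (a k))" using B_mor_verts[OF dom.mor[OF le] q'(1)] by blast
  then have "(q', q') \<in> N (a k)" by (rule dom.near_refl)
  then have "(p, q') \<in> R l (a k)" using k(4) q'(2) by blast
  then have "(p, s) \<in> R l (a (Suc j))" by (rule dom.bond_trans[OF _ q'(1) k(2) le])
  then show "z \<in> S" using up[OF j(1)] zlp k(2) le by (simp add: dom.order_iff)
qed

lemma homeomorphic: "sequence_spectrum G R homeomorphic_space sequence_spectrum H Q"
proof -
  interpret sw: zigzag H Q M G R N b "a \<circ> Suc" T' "T \<circ> Suc" by (rule swap)
  have sub: "sw.D \<subseteq> E" unfolding transfer_def by fastforce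
  show ?thesis
    unfolding sequence_spectrum_def
  proof (rule homeomorphic_spectra)
    show "D `` S \<in> spectrum cod.P cod.r" if "S \<in> spectrum dom.P dom.r" for S
      using that by (rule D_spectrum)
    show "sw.D `` S \<in> spectrum dom.P dom.r" if "S \<in> spectrum cod.P cod.r" for S
      using that by (rule sw.D_spectrum)
    show "sw.D `` (D `` S) \<subseteq> S" if "S \<in> spectrum dom.P dom.r" for S
      using E_D_subset[OF that] sub by blast
    show "D `` (sw.D `` S) \<subseteq> S" if "S \<in> spectrum cod.P cod.r" for S
      using sw.E_D_subset[OF that] by simp
  qed
qed

end

lemma homeomorphic_if_lax_zigzag:
  assumes G: "near_sequence G R (\<lambda>n. adj (G n))" and H: "near_sequence H Q (\<lambda>n. adj (H n))"
    and mono: "strict_mono a" "strict_mono b"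
    and T: "\<And>k. T k \<in> B_mor (H (b k)) (G (a k))"
    and T': "\<And>k. T' k \<in> B_mor (G (a (Suc k))) (H (b k))"
    and TT': "\<And>k. T k O T' k \<subseteq> R (a k) (a (Suc k))"
    and T'T: "\<And>k. T' k O T (Suc k) \<subseteq> Q (b k) (b (Suc k))"
  shows "sequence_spectrum G R homeomorphic_space sequence_spectrum H Q"
proof -
  interpret G: near_sequence G R "\<lambda>n. adj (G n)" by fact
  interpret H: near_sequence H Q "\<lambda>n. adj (H n)" by fact
  have le: "a i \<le> a j" "b i \<le> b j" if "i \<le> j" for i j
    using that mono by (auto simp: strict_mono_less_eq)
  text \<open>Walking from \<open>x\<close> along the zigzag itself stays below both bonding relations.\<close>
  have walk: "\<exists>q y. (q, y) \<in> T k \<and> (y, x) \<in> Q (b k) (b j) \<and>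
      (\<forall>s. (x, s) \<in> T' j \<longrightarrow> (q, s) \<in> R (a k) (a (Suc j)))"
    if kj: "k \<le> j" and x: "x \<in> verts (H (b j))" for k j x
    using kj
  proof (induction k rule: inc_induct)
    case base
    obtain q where q: "(q, x) \<in> T j" using B_mor_image[OF T x] by blast
    then show ?case using TT'[of j] H.ident x by blast
  next
    case (step k)
    then obtain q y where qy: "(q, y) \<in> T (Suc k)" "(y, x) \<in> Q (b (Suc k)) (b j)"
      "\<And>s. (x, s) \<in> T' j \<Longrightarrow> (q, s) \<in> R (a (Suc k)) (a (Suc j))"
      by blast
    obtain y' where y': "(y', q) \<in> T' k" using B_mor_image[OF T'] B_mor_verts[OF T qy(1)] by blast
    obtain q' where q': "(q', y') \<in> T k" using B_mor_image[OF T] B_mor_verts[OF T' y'] by blast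
    have "(y', x) \<in> Q (b k) (b j)"
      using H.bond_trans[of y' y "b k" "b (Suc k)" x "b j"] T'T[of k] y' qy le step.hyps by auto
    moreover have "(q', s) \<in> R (a k) (a (Suc j))" if "(x, s) \<in> T' j" for s
      using G.bond_trans[of q' q "a k" "a (Suc k)" s "a (Suc j)"] TT'[of k] y' q' qy(3)[OF that] le step.hyps
      by auto
    ultimately show ?case using q' by blast
  qed
  have walk': "\<exists>y q. (y, q) \<in> T' k \<and> (q, s) \<in> R (a (Suc k)) (a (Suc j)) \<and>
      (\<forall>x. (s, x) \<in> T (Suc j) \<longrightarrow> (y, x) \<in> Q (b k) (b (Suc j)))"
    if kj: "k \<le> j" and s: "s \<in> verts (G (a (Suc j)))" for k j s
    using kj
  proof (induction k rule: inc_induct)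
    case base
    obtain q where q: "(q, s) \<in> T' j" using B_mor_image[OF T' s] by blast
    then show ?case using T'T[of j] G.ident s by blast
  next
    case (step k)
    then obtain y q where qy: "(y, q) \<in> T' (Suc k)" "(q, s) \<in> R (a (Suc (Suc k))) (a (Suc j))"
      "\<And>x. (s, x) \<in> T (Suc j) \<Longrightarrow> (y, x) \<in> Q (b (Suc k)) (b (Suc j))"
      by blast
    obtain q' where q': "(q', y) \<in> T (Suc k)" using B_mor_image[OF T] B_mor_verts[OF T' qy(1)] by blast
    obtain y' where y': "(y', q') \<in> T' k" using B_mor_image[OF T'] B_mor_verts[OF T q'] by blast
    have "(q', s) \<in> R (a (Suc k)) (a (Suc j))"
      using G.bond_trans[of q' q "a (Suc k)" "a (Suc (Suc k))" s "a (Suc j)"] TT'[of "Suc k"] q' qy le step.hyps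
      by auto
    moreover have "(y', x) \<in> Q (b k) (b (Suc j))" if "(s, x) \<in> T (Suc j)" for x
      using H.bond_trans[of y' y "b k" "b (Suc k)" x "b (Suc j)"] T'T[of k] y' q' qy(3)[OF that] le step.hyps
      by auto
    ultimately show ?case using y' by blast
  qed
  interpret zigzag G R "\<lambda>n. adj (G n)" H Q "\<lambda>n. adj (H n)" a b T T'
  proof unfold_locales
    show "lifts (adj (H (b k))) (adj (G (a k))) (T k)" for k
      using lifts_adj T H.graph by blast
    show "lifts (adj (G (a (Suc k)))) (adj (H (b k))) (T' k)" for k
      using lifts_adj T' G.graph by blast
  next
    fix k j q y x s
    assume *: "k \<le> j" "(q, y) \<in> T k" "(y, x) \<in> Q (b k) (b j)" "(x, s) \<in> T' j"
    have x: "x \<in> verts (H (b j))" using B_mor_verts[OF T' *(4)] by blast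
    then obtain q' y' where q': "(q', y') \<in> T k" "(y', x) \<in> Q (b k) (b j)"
      "(q', s) \<in> R (a k) (a (Suc j))"
      using walk[OF *(1)] *(4) by blast
    have "(y, y') \<in> adj (H (b k))"
      using B_mor_edge[OF H.mor[OF le(2)[OF *(1)]] *(3) q'(2)] H.near_refl x by blast
    then have "(q, q') \<in> adj (G (a k))" using B_mor_edge[OF T *(2) q'(1)] by blast
    then show "\<exists>q'. (q', s) \<in> R (a k) (a (Suc j)) \<and> (q, q') \<in> adj (G (a k))"
      using q'(3) by blast
  next
    fix k j y q s x
    assume *: "k \<le> j" "(y, q) \<in> T' k" "(q, s) \<in> R (a (Suc k)) (a (Suc j))" "(s, x) \<in> T (Suc j)"
    have s: "s \<in> verts (G (a (Suc j)))" using B_mor_verts[OF T *(4)] by blast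
    then obtain y' q' where y': "(y', q') \<in> T' k" "(q', s) \<in> R (a (Suc k)) (a (Suc j))"
      "(y', x) \<in> Q (b k) (b (Suc j))"
      using walk'[OF *(1)] *(4) by blast
    have "(q, q') \<in> adj (G (a (Suc k)))"
      using B_mor_edge[OF G.mor[OF le(1)] *(3) y'(2)] G.near_refl s *(1) by simp
    then have "(y, y') \<in> adj (H (b k))" using B_mor_edge[OF T' *(2) y'(1)] by blast
    then show "\<exists>y'. (y', x) \<in> Q (b k) (b (Suc j)) \<and> (y, y') \<in> adj (H (b k))"
      using y'(3) by blast
  qed (use mono T T' in auto)
  show ?thesis by (rule homeomorphic)
qed

lemma homeomorphic_if_strict_zigzag:
  assumes G: "graph_sequence G R" and H: "graph_sequence H Q"
    and mono: "strict_mono a" "strict_mono b"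
    and T: "\<And>k. T k \<in> B_mor (H (b k)) (G (a k))"
    and T': "\<And>k. T' k \<in> B_mor (G (a (Suc k))) (H (b k))"
    and TT': "\<And>k. T k O T' k = R (a k) (a (Suc k))"
    and T'T: "\<And>k. T' k O T (Suc k) = Q (b k) (b (Suc k))"
  shows "sequence_spectrum G R homeomorphic_space sequence_spectrum H Q"
proof -
  interpret G: graph_sequence G R by fact
  interpret H: graph_sequence H Q by fact
  interpret GI: near_sequence G R "\<lambda>n. Id_on (verts (G n))" by (rule G.near_sequence_Id)
  interpret HI: near_sequence H Q "\<lambda>n. Id_on (verts (H n))" by (rule H.near_sequence_Id)
  have le: "a i \<le> a j" "b i \<le> b j" if "i \<le> j" for i j
    using that mono by (auto simp: strict_mono_less_eq)
  have stepG: "R (a k) (a j) O R (a j) (a (Suc j)) = R (a k) (a (Suc j))" if "k \<le> j" for k j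
    using that le G.comp by simp
  have stepH: "Q (b k) (b j) O Q (b j) (b (Suc j)) = Q (b k) (b (Suc j))" if "k \<le> j" for k j
    using that le H.comp by simp
  have TQT: "T k O Q (b k) (b j) O T' j = R (a k) (a (Suc j))" if "k \<le> j" for k j
    using that
  proof (induction j rule: dec_induct)
    case base
    have "Q (b k) (b k) O T' k = T' k" by (simp add: H.ident Id_on_comp_B_mor[OF T'])
    then show ?case by (simp add: TT')
  next
    case (step j)
    have "T k O Q (b k) (b (Suc j)) O T' (Suc j) = (T k O Q (b k) (b j) O T' j) O (T (Suc j) O T' (Suc j))"
      using stepH[OF step.hyps(1)] T'T[of j] by (metis O_assoc)
    also have "\<dots> = R (a k) (a (Suc (Suc j)))" using step stepG[of k "Suc j"] TT' by simp
    finally show ?case .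
  qed
  have TRT: "T' k O R (a (Suc k)) (a (Suc j)) O T (Suc j) = Q (b k) (b (Suc j))" if "k \<le> j" for k j
    using that
  proof (induction j rule: dec_induct)
    case base
    have "R (a (Suc k)) (a (Suc k)) O T (Suc k) = T (Suc k)"
      by (simp add: G.ident Id_on_comp_B_mor[OF T])
    then show ?case by (simp add: T'T)
  next
    case (step j)
    have "T' k O R (a (Suc k)) (a (Suc (Suc j))) O T (Suc (Suc j)) =
        (T' k O R (a (Suc k)) (a (Suc j)) O T (Suc j)) O (T' (Suc j) O T (Suc (Suc j)))"
      using stepG[of "Suc k" "Suc j"] step.hyps TT'[of "Suc j"] by (metis O_assoc Suc_le_mono)
    also have "\<dots> = Q (b k) (b (Suc (Suc j)))" using step stepH[of k "Suc j"] T'T by simp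
    finally show ?case .
  qed
  interpret zigzag G R "\<lambda>n. Id_on (verts (G n))" H Q "\<lambda>n. Id_on (verts (H n))" a b T T'
  proof unfold_locales
    show "lifts (Id_on (verts (H (b k)))) (Id_on (verts (G (a k)))) (T k)" for k
      using lifts_Id_on T by blast
    show "lifts (Id_on (verts (G (a (Suc k))))) (Id_on (verts (H (b k)))) (T' k)" for k
      using lifts_Id_on T' by blast
  next
    fix k j q y x s
    assume *: "k \<le> j" "(q, y) \<in> T k" "(y, x) \<in> Q (b k) (b j)" "(x, s) \<in> T' j"
    then have "(q, s) \<in> R (a k) (a (Suc j))" using TQT by blast
    then show "\<exists>q'. (q', s) \<in> R (a k) (a (Suc j)) \<and> (q, q') \<in> Id_on (verts (G (a k)))"
      using B_mor_verts[OF T *(2)] by blast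
  next
    fix k j y q s x
    assume *: "k \<le> j" "(y, q) \<in> T' k" "(q, s) \<in> R (a (Suc k)) (a (Suc j))" "(s, x) \<in> T (Suc j)"
    then have "(y, x) \<in> Q (b k) (b (Suc j))" using TRT by blast
    then show "\<exists>y'. (y', x) \<in> Q (b k) (b (Suc j)) \<and> (y, y') \<in> Id_on (verts (H (b k)))"
      using B_mor_verts[OF T' *(2)] by blast
  qed (use mono T T' in auto)
  show ?thesis by (rule homeomorphic)
qed


section \<open>Back and forth\<close>

text \<open>The relation \<open>\<rho>\<close> is inclusion for lax-Fraisse and equality for Fraisse sequences.\<close>

definition absorbing ::
    "('a rel \<Rightarrow> 'a rel \<Rightarrow> bool) \<Rightarrow> 'a graph set \<Rightarrow> ('a graph \<Rightarrow> 'a graph \<Rightarrow> 'a rel set) \<Rightarrow>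
     (nat \<Rightarrow> 'a graph) \<Rightarrow> (nat \<Rightarrow> nat \<Rightarrow> 'a rel) \<Rightarrow> bool" where
  "absorbing \<rho> Ob Mor G R \<longleftrightarrow>
     (\<forall>m. \<forall>K\<in>Ob. \<forall>T\<in>Mor K (G m). \<exists>n\<ge>m. \<exists>T'\<in>Mor (G n) K. \<rho> (T O T') (R m n))"

lemma absorbing_greater:
  assumes C: "subcategory_of_B Ob Mor" and G: "is_sequence Ob Mor G R"
    and abs: "absorbing \<rho> Ob Mor G R" and \<rho>: "\<forall>A B X. \<rho> A B \<longrightarrow> \<rho> (A O X) (B O X)"
    and K: "K \<in> Ob" "T \<in> Mor K (G m)"
  shows "\<exists>n>m. \<exists>T'\<in>Mor (G n) K. \<rho> (T O T') (R m n)"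
proof -
  obtain n T' where n: "n \<ge> m" "T' \<in> Mor (G n) K" "\<rho> (T O T') (R m n)"
    using abs K unfolding absorbing_def by blast
  have "T' O R n (Suc n) \<in> Mor (G (Suc n)) K"
    using C G K n unfolding subcategory_of_B_def is_sequence_def by (meson le_SucI order_refl)
  moreover have "R m n O R n (Suc n) = R m (Suc n)"
    using G n unfolding is_sequence_def by simp
  then have "\<rho> (T O T' O R n (Suc n)) (R m (Suc n))" using \<rho>[rule_format, OF n(3)] by (metis O_assoc)
  ultimately show ?thesis using n(1) by (meson le_imp_less_Suc)
qed

lemma zigzag_exists:
  assumes C: "subcategory_of_B Ob Mor"
    and G: "is_sequence Ob Mor G R" and H: "is_sequence Ob Mor H Q"
    and absG: "absorbing \<rho> Ob Mor G R" and absH: "absorbing \<rho> Ob Mor H Q"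
    and cof: "cofinal_sequence Ob Mor H"
    and \<rho>: "\<forall>A B X. \<rho> A B \<longrightarrow> \<rho> (A O X) (B O X)"
  shows "\<exists>a b T T'. strict_mono a \<and> strict_mono b \<and> (\<forall>k. T k \<in> Mor (H (b k)) (G (a k)) \<and>
    T' k \<in> Mor (G (a (Suc k))) (H (b k)) \<and> \<rho> (T k O T' k) (R (a k) (a (Suc k))) \<and>
    \<rho> (T' k O T (Suc k)) (Q (b k) (b (Suc k))))"
proof -
  have Ob: "G n \<in> Ob" "H n \<in> Ob" for n using G H by (simp_all add: is_sequence_def)
  define ok where "ok = (\<lambda>(m, n, T). T \<in> Mor (H n) (G m))"
  define next_of where "next_of = (\<lambda>(m, n, T) (m', n', T'').
    m < m' \<and> n < n' \<and> (\<exists>T'\<in>Mor (G m') (H n). \<rho> (T O T') (R m m') \<and> \<rho> (T' O T'') (Q n n')))"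
  have "\<exists>f. \<forall>k. ok (f k) \<and> next_of (f k) (f (Suc k))"
  proof (rule dependent_nat_choice)
    obtain n T where "T \<in> Mor (H n) (G 0)"
      using cof Ob(1)[of 0] unfolding cofinal_sequence_def by blast
    then have "ok (0, n, T)" by (simp add: ok_def)
    then show "\<exists>s. ok s" ..
  next
    fix s :: "nat \<times> nat \<times> 'a rel" and k :: nat
    assume "ok s"
    moreover obtain m n T where s: "s = (m, n, T)" by (cases s)
    ultimately have T: "T \<in> Mor (H n) (G m)" by (simp add: ok_def)
    obtain m' T' where m': "m' > m" "T' \<in> Mor (G m') (H n)" "\<rho> (T O T') (R m m')"
      using absorbing_greater[OF C G absG \<rho> Ob(2) T] by blast
    obtain n' T'' where n': "n' > n" "T'' \<in> Mor (H n') (G m')" "\<rho> (T' O T'') (Q n n')"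
      using absorbing_greater[OF C H absH \<rho> Ob(1) m'(2)] by blast
    have "ok (m', n', T'')" "next_of s (m', n', T'')"
      unfolding s ok_def next_of_def prod.case using m' n' by blast+
    then have "ok (m', n', T'') \<and> next_of s (m', n', T'')" ..
    then show "\<exists>t. ok t \<and> next_of s t" ..
  qed
  then obtain f where "\<forall>k. ok (f k) \<and> next_of (f k) (f (Suc k))" ..
  then have f: "ok (f k)" "next_of (f k) (f (Suc k))" for k by simp_all
  define a b T where "a = (\<lambda>k. fst (f k))" and "b = (\<lambda>k. fst (snd (f k)))"
    and "T = (\<lambda>k. snd (snd (f k)))"
  have fk: "f k = (a k, b k, T k)" for k by (simp add: a_def b_def T_def)
  have T: "T k \<in> Mor (H (b k)) (G (a k))" for k
    using f(1)[of k] by (simp add: fk ok_def)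
  have nx: "a k < a (Suc k)" "b k < b (Suc k)"
    "\<exists>T'. T' \<in> Mor (G (a (Suc k))) (H (b k)) \<and> \<rho> (T k O T') (R (a k) (a (Suc k))) \<and>
      \<rho> (T' O T (Suc k)) (Q (b k) (b (Suc k)))" for k
    using f(2)[of k] unfolding fk next_of_def prod.case by (blast, blast, blast)
  have "\<forall>k. \<exists>T'. T' \<in> Mor (G (a (Suc k))) (H (b k)) \<and>
      \<rho> (T k O T') (R (a k) (a (Suc k))) \<and> \<rho> (T' O T (Suc k)) (Q (b k) (b (Suc k)))"
    using nx(3) by (rule allI)
  from choice[OF this] obtain T' where "\<forall>k. T' k \<in> Mor (G (a (Suc k))) (H (b k)) \<and>
      \<rho> (T k O T' k) (R (a k) (a (Suc k))) \<and> \<rho> (T' k O T (Suc k)) (Q (b k) (b (Suc k)))" ..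
  moreover have "strict_mono a" "strict_mono b"
    using nx(1,2) by (simp_all add: strict_mono_Suc_iff)
  ultimately show ?thesis using T by (intro exI[of _ a] exI[of _ b] exI[of _ T] exI[of _ T']) simp
qed

lemma graph_sequence_if_is_sequence:
  assumes "subcategory_of_B Ob Mor" "is_sequence Ob Mor G R"
  shows "graph_sequence G R"
proof
  have Ob: "G n \<in> Ob" for n using assms(2) by (simp add: is_sequence_def)
  show "is_graph (G n)" for n using assms(1) Ob by (simp add: subcategory_of_B_def)
  show "R m n \<in> B_mor (G n) (G m)" if "m \<le> n" for m n
  proof -
    have "Mor (G n) (G m) \<subseteq> B_mor (G n) (G m)"
      using assms(1) Ob by (simp add: subcategory_of_B_def)
    moreover have "R m n \<in> Mor (G n) (G m)" using assms(2) that by (simp add: is_sequence_def)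
    ultimately show ?thesis ..
  qed
qed (use assms(2) in \<open>simp_all add: is_sequence_def\<close>)

theorem proposition4p32:
  fixes Ob :: "'a graph set"
    and Mor :: "'a graph \<Rightarrow> 'a graph \<Rightarrow> 'a rel set"
    and G H :: "nat \<Rightarrow> 'a graph"
    and R Q :: "nat \<Rightarrow> nat \<Rightarrow> 'a rel"
  assumes "subcategory_of_B Ob Mor"
    and "is_sequence Ob Mor G R"
    and "is_sequence Ob Mor H Q"
    and "(lax_fraisse Ob Mor G R \<and> lax_fraisse Ob Mor H Q \<and>
          has_edge_witnessing_star_refining_subsequence G R \<and>
          has_edge_witnessing_star_refining_subsequence H Q) \<or>
         (fraisse Ob Mor G R \<and> fraisse Ob Mor H Q)"
  shows "sequence_spectrum G R homeomorphic_space sequence_spectrum H Q"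
proof -
  note C = assms(1) and G = assms(2) and H = assms(3)
  interpret G: graph_sequence G R using C G by (rule graph_sequence_if_is_sequence)
  interpret H: graph_sequence H Q using C H by (rule graph_sequence_if_is_sequence)
  have "G n \<in> Ob" "H n \<in> Ob" for n using G H by (simp_all add: is_sequence_def)
  then have B: "Mor (G m) (H n) \<subseteq> B_mor (G m) (H n)" "Mor (H n) (G m) \<subseteq> B_mor (H n) (G m)" for m n
    using C by (simp_all add: subcategory_of_B_def)
  from assms(4) show ?thesis
  proof (elim disjE conjE)
    assume "lax_fraisse Ob Mor G R" "lax_fraisse Ob Mor H Q"
      and sub: "has_edge_witnessing_star_refining_subsequence G R"
        "has_edge_witnessing_star_refining_subsequence H Q"
    then have abs: "absorbing (\<subseteq>) Ob Mor G R" "absorbing (\<subseteq>) Ob Mor H Q" "cofinal_sequence Ob Mor H"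
      unfolding lax_fraisse_def absorbing_def by simp_all
    have "\<forall>A B X :: 'a rel. A \<subseteq> B \<longrightarrow> A O X \<subseteq> B O X" by blast
    from zigzag_exists[OF C G H abs this] obtain a b T T'
      where "strict_mono a \<and> strict_mono b \<and> (\<forall>k. T k \<in> Mor (H (b k)) (G (a k)) \<and>
      T' k \<in> Mor (G (a (Suc k))) (H (b k)) \<and> T k O T' k \<subseteq> R (a k) (a (Suc k)) \<and>
      T' k O T (Suc k) \<subseteq> Q (b k) (b (Suc k)))"
      by (elim exE) (rule that)
    then have *: "strict_mono a" "strict_mono b"
      "\<And>k. T k \<in> Mor (H (b k)) (G (a k))" "\<And>k. T' k \<in> Mor (G (a (Suc k))) (H (b k))"
      "\<And>k. T k O T' k \<subseteq> R (a k) (a (Suc k))" "\<And>k. T' k O T (Suc k) \<subseteq> Q (b k) (b (Suc k))"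
      by simp_all
    note near = G.near_sequence_adj[OF sub(1)] H.near_sequence_adj[OF sub(2)]
    show ?thesis
    proof (rule homeomorphic_if_lax_zigzag[where a = a and b = b and T = T and T' = T'])
      show "T k \<in> B_mor (H (b k)) (G (a k))" "T' k \<in> B_mor (G (a (Suc k))) (H (b k))" for k
        using *(3,4)[of k] B by (simp_all add: subset_iff)
    qed (fact near *)+
  next
    assume "fraisse Ob Mor G R" "fraisse Ob Mor H Q"
    then have abs: "absorbing (=) Ob Mor G R" "absorbing (=) Ob Mor H Q" "cofinal_sequence Ob Mor H"
      unfolding fraisse_def absorbing_def by simp_all
    have "\<forall>A B X :: 'a rel. A = B \<longrightarrow> A O X = B O X" by simp
    from zigzag_exists[OF C G H abs this] obtain a b T T'
      where "strict_mono a \<and> strict_mono b \<and> (\<forall>k. T k \<in> Mor (H (b k)) (G (a k)) \<and>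
      T' k \<in> Mor (G (a (Suc k))) (H (b k)) \<and> T k O T' k = R (a k) (a (Suc k)) \<and>
      T' k O T (Suc k) = Q (b k) (b (Suc k)))"
      by (elim exE) (rule that)
    then have *: "strict_mono a" "strict_mono b"
      "\<And>k. T k \<in> Mor (H (b k)) (G (a k))" "\<And>k. T' k \<in> Mor (G (a (Suc k))) (H (b k))"
      "\<And>k. T k O T' k = R (a k) (a (Suc k))" "\<And>k. T' k O T (Suc k) = Q (b k) (b (Suc k))"
      by simp_all
    show ?thesis
    proof (rule homeomorphic_if_strict_zigzag[where a = a and b = b and T = T and T' = T'])
      show "T k \<in> B_mor (H (b k)) (G (a k))" "T' k \<in> B_mor (G (a (Suc k))) (H (b k))" for k
        using *(3,4)[of k] B by (simp_all add: subset_iff)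
    qed (fact G.graph_sequence_axioms H.graph_sequence_axioms *)+
  qed
qed

end
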